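(* Assume the $abc$-conjecture. Then $\theta_3 = \frac{1}{2}$.
   Context: A positive integer $n$ is powerful if $p^2 \mid n$ for every prime $p \mid n$. For an integer $k \ge 3$, a $k$-term arithmetic progression of powerful numbers is a sequence $N, N+d, \dots, N+(k-1)d$ with positive integers $N$ and $d$ (so $d>0$) all of whose terms are powerful. A real number $0<\theta<1$ is called an admissible exponent (for $k$) if there exists a constant $C_\theta>0$ such that there are infinitely many $k$-term arithmetic progressions of powerful numbers $N, N+d, \dots, N+(k-1)d$ with $d \le C_\theta N^\theta$; $\theta_k$ denotes the infimum of all admissible exponents for $k$. The $abc$-conjecture states: for every $\epsilon>0$ there is a constant $C_\epsilon>0$ such that for all integers $a,b,c$ with $a+b=c$ and $\gcd(a,b)=1$, one has $\max\{|a|,|b|,|c|\} \le C_\epsilon\, \kappa(abc)^{1+\epsilon}$, where $\kappa(m)=\prod_{p\mid m} p$ is the product of the distinct primes dividing $m$. *)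

theory Defs
  imports Complex_Main "HOL-Computational_Algebra.Primes"
begin

definition powerful :: "nat \<Rightarrow> bool" where
  "powerful n \<longleftrightarrow> n > 0 \<and> (\<forall>p. prime p \<longrightarrow> p dvd n \<longrightarrow> p\<^sup>2 dvd n)"

text \<open>A progression \<open>N, N + d, \<dots>, N + (k - 1) d\<close> is identified with the pair \<open>(N, d)\<close>.\<close>

definition powerful_AP :: "nat \<Rightarrow> nat \<Rightarrow> nat \<Rightarrow> bool" where
  "powerful_AP k N d \<longleftrightarrow> N > 0 \<and> d > 0 \<and> (\<forall>i<k. powerful (N + i * d))"

definition admissible_exponent :: "nat \<Rightarrow> real \<Rightarrow> bool" where
  "admissible_exponent k \<theta> \<longleftrightarrow> 0 < \<theta> \<and> \<theta> < 1 \<and>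
     (\<exists>C>0. infinite {(N, d). powerful_AP k N d \<and> real d \<le> C * real N powr \<theta>})"

text \<open>The infimum is taken in the reals, so its value is unspecified if no exponent is admissible.\<close>

definition theta :: "nat \<Rightarrow> real" where
  "theta k = Inf {\<theta>. admissible_exponent k \<theta>}"

text \<open>Here \<open>\<kappa>(0) = 1\<close>. In the \<open>abc\<close>-conjecture this only concerns the finitely many triples
  with \<open>a b c = 0\<close>, for which coprimality forces \<open>max {|a|, |b|, |c|} = 1\<close>.\<close>

definition kappa :: "int \<Rightarrow> int" where
  "kappa m = (\<Prod>p\<in>prime_factors m. p)"

definition abc_conjecture :: bool where
  "abc_conjecture \<longleftrightarrow>
     (\<forall>\<epsilon>::real. \<epsilon> > 0 \<longrightarrow> (\<exists>C::real. C > 0 \<and>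
        (\<forall>a b c :: int. a + b = c \<longrightarrow> gcd a b = 1 \<longrightarrow>
           real_of_int (Max {\<bar>a\<bar>, \<bar>b\<bar>, \<bar>c\<bar>}) \<le> C * real_of_int (kappa (a * b * c)) powr (1 + \<epsilon>))))"

end

theory Submission
  imports Defs "HOL-Library.Infinite_Set"
begin

text \<open>Upper bound: if \<open>z\<^sup>2 - 2 v\<^sup>2 = -1\<close>, then \<open>4 (2v - 2)\<^sup>2\<close>, \<open>4 (2v - 1)\<^sup>2\<close>, \<open>8 z\<^sup>2\<close> is a
  progression of powerful numbers with \<open>d\<close> of order \<open>N\<^sup>1\<^sup>/\<^sup>2\<close>, and this Pell equation has infinitely
  many solutions, so that \<open>1/2\<close> is itself admissible.

  Lower bound: put \<open>g = gcd N d\<close>, \<open>N = g n\<close>, \<open>d = g e\<close> and apply \<open>abc\<close> to the coprime identity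
  \<open>e\<^sup>2 + n (n + 2e) = (n + e)\<^sup>2\<close>. A prime \<open>p\<close> dividing one of the three terms \<open>n + i e\<close> satisfies
  \<open>p\<^sup>2 | g (n + i e)\<close>, whence \<open>\<kappa>\<^sup>2 | e\<^sup>2 g n (n + e) (n + 2e)\<close>. This gives
  \<open>N\<^sup>2 \<le> C (d N\<^sup>3\<^sup>/\<^sup>2)\<^sup>1\<^sup>+\<^sup>\<epsilon>\<close> up to the value of \<open>C\<close>, which bounds \<open>N\<close> as soon as \<open>d\<close> is at most
  of order \<open>N\<^sup>\<theta>\<close> with \<open>\<theta> < 1/2\<close>.\<close>

section \<open>Powerful numbers and Pell progressions\<close>

lemma powerful_mult:
  assumes "powerful m" "powerful n"
  shows "powerful (m * n)"
  using assms unfolding powerful_def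
  by (auto simp: prime_dvd_mult_iff intro: dvd_mult dvd_mult2)

lemma powerful_power:
  assumes "x > 0" "k \<ge> 2"
  shows "powerful (x ^ k)"
  unfolding powerful_def
proof (intro conjI allI impI)
  fix p :: nat
  assume "prime p" "p dvd x ^ k"
  then have "p\<^sup>2 dvd x\<^sup>2"
    using prime_dvd_power dvd_power_same by blast
  also have "x\<^sup>2 dvd x ^ k"
    using \<open>k \<ge> 2\<close> by (rule le_imp_power_dvd)
  finally show "p\<^sup>2 dvd x ^ k" .
qed (use assms in simp)

lemma negative_Pell_2_unbounded:
  "\<exists>v z :: nat. v > B \<and> z\<^sup>2 + 1 = 2 * v\<^sup>2"
proof (induction B)
  case 0
  show ?case by (rule exI[of _ 1], rule exI[of _ 1]) simp
next
  case (Suc B)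
  then obtain v z :: nat where vz: "v > B" "z\<^sup>2 + 1 = 2 * v\<^sup>2" by blast
  \<comment> \<open>Multiplication of \<open>z + v sqrt 2\<close> by the unit
    \<open>3 + 2 sqrt 2\<close> of norm 1 preserves the norm -1.\<close>
  have "(3 * z + 4 * v)\<^sup>2 + 1 = 2 * (2 * z + 3 * v)\<^sup>2"
    using vz(2) by (simp add: power2_eq_square algebra_simps)
  moreover have "2 * z + 3 * v > Suc B"
    using vz(1) by simp
  ultimately show ?case by blast
qed

text \<open>Two consecutive squares force the third term:
  \<open>2 (2v - 1)^2 - (2v - 2)^2 = 2 (2 v^2 - 1) = 2 z^2\<close>. The common factor 4 turns it
  into \<open>2^3 z^2\<close>, which is powerful. For \<open>v = 1\<close> the first term would be
  0.\<close>

lemma powerful_AP_of_negative_Pell: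
  assumes "v > 1" "z\<^sup>2 + 1 = 2 * v\<^sup>2"
  shows "powerful_AP 3 (4 * (2 * v - 2)\<^sup>2) (4 * (4 * v - 3))"
proof -
  \<comment> \<open>This substitution removes the truncated subtractions.\<close>
  obtain u where u: "v = u + 2"
    using assms(1) by (metis nat_le_iff_add Suc_leI add.commute Suc_1)
  have z: "z\<^sup>2 = 2 * u\<^sup>2 + 8 * u + 7"
    using assms(2) by (simp add: u power2_eq_square algebra_simps)
  have "z > 0"
    using z by (cases "z = 0") auto
  have "powerful (2 ^ 2 * (2 * u + 2)\<^sup>2)" "powerful (2 ^ 2 * (2 * u + 3)\<^sup>2)" "powerful (2 ^ 3 * z\<^sup>2)"
    using \<open>z > 0\<close> by (intro powerful_mult powerful_power; simp)+
  moreover have "2 ^ 2 * (2 * u + 2)\<^sup>2 = 4 * (2 * v - 2)\<^sup>2 + 0 * (4 * (4 * v - 3))"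
    by (simp add: u)
  moreover have "2 ^ 2 * (2 * u + 3)\<^sup>2 = 4 * (2 * v - 2)\<^sup>2 + 1 * (4 * (4 * v - 3))"
    by (simp add: u power2_eq_square algebra_simps)
  moreover have "2 ^ 3 * z\<^sup>2 = 4 * (2 * v - 2)\<^sup>2 + 2 * (4 * (4 * v - 3))"
    unfolding z by (simp add: u power2_eq_square algebra_simps)
  ultimately have "powerful (4 * (2 * v - 2)\<^sup>2 + i * (4 * (4 * v - 3)))" if "i = 0 \<or> i = 1 \<or> i = 2" for i
    using that by metis
  moreover have "i = 0 \<or> i = 1 \<or> i = 2" if "i < 3" for i :: nat
    using that by linarith
  moreover have "4 * (2 * v - 2)\<^sup>2 > 0" "4 * (4 * v - 3) > 0"
    using assms(1) by simp_all
  ultimately show ?thesis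
    unfolding powerful_AP_def by blast
qed

lemma admissible_exponent_half: "admissible_exponent 3 (1 / 2)"
proof -
  \<comment> \<open>In the family, \<open>sqrt N = 4v - 4\<close> and \<open>d = 16v - 12\<close>,
    so the constant 10 suffices for all \<open>v \<ge> 2\<close>, with room to spare.\<close>
  let ?S = "{(N, d). powerful_AP 3 N d \<and> real d \<le> 10 * real N powr (1 / 2)}"
  have "infinite (fst ` ?S)"
    unfolding infinite_nat_iff_unbounded
  proof
    fix B :: nat
    obtain v z :: nat where v: "v > B + 1" and vz: "z\<^sup>2 + 1 = 2 * v\<^sup>2"
      using negative_Pell_2_unbounded by blast
    let ?N = "4 * (2 * v - 2)\<^sup>2" and ?d = "4 * (4 * v - 3)"
    have "powerful_AP 3 ?N ?d"
      using v vz by (intro powerful_AP_of_negative_Pell) auto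
    moreover have "real ?N powr (1 / 2) = 4 * real v - 4"
    proof -
      have "real ?N = (4 * real v - 4)\<^sup>2"
      proof -
        have "real ?N = 4 * (real (2 * v - 2))\<^sup>2"
          by simp
        also have "real (2 * v - 2) = 2 * real v - 2"
          using v by (simp add: of_nat_diff)
        finally show ?thesis
          by (simp add: power2_eq_square algebra_simps)
      qed
      then show ?thesis
        using v by (simp add: powr_half_sqrt)
    qed
    then have "real ?d \<le> 10 * real ?N powr (1 / 2)"
      using v by (simp add: of_nat_diff)
    ultimately have "?N \<in> fst ` ?S"
      by (intro image_eqI[of _ _ "(?N, ?d)"]) auto
    moreover have "?N > B"
    proof -
      have "B < 2 * v - 2" using v by simp
      also have "\<dots> \<le> (2 * v - 2)\<^sup>2" using v by (simp add: self_le_power)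
      also have "\<dots> \<le> ?N" by simp
      finally show ?thesis .
    qed
    ultimately show "\<exists>n>B. n \<in> fst ` ?S" by blast
  qed
  then have "infinite ?S"
    using finite_imageI by blast
  then show ?thesis
    unfolding admissible_exponent_def by (intro conjI exI[of _ "10::real"]) auto
qed

section \<open>The radical and the consequence of abc for one progression\<close>

text \<open>Squares of distinct primes are coprime, so if each divides \<open>M\<close>, their
  product does too. Induction runs over finite sets of prime factors.\<close>

lemma kappa_power2_dvd:
  assumes "\<And>p. prime p \<Longrightarrow> p dvd m \<Longrightarrow> p\<^sup>2 dvd M"
  shows "(kappa m)\<^sup>2 dvd M"
proof -
  have "(\<Prod>p\<in>A. p)\<^sup>2 dvd M" if "finite A" "A \<subseteq> prime_factors m" for A
    using that
  proof (induction A rule: finite_induct)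
    case (insert p A)
    have "coprime p q" if "q \<in> A" for q
      using insert that by (intro primes_coprime) auto
    then have "coprime (p\<^sup>2) ((\<Prod>p\<in>A. p)\<^sup>2)"
      by (auto intro: prod_coprime_right)
    moreover have "p\<^sup>2 dvd M"
      using insert.prems by (intro assms) auto
    ultimately show ?case
      using insert by (simp add: power_mult_distrib divides_mult)
  qed simp
  then show ?thesis
    unfolding kappa_def by simp
qed

lemma abc_powerful_AP_bound:
  assumes abc: "\<And>a b c :: int. a + b = c \<Longrightarrow> gcd a b = 1 \<Longrightarrow>
      real_of_int (Max {\<bar>a\<bar>, \<bar>b\<bar>, \<bar>c\<bar>}) \<le> C * real_of_int (kappa (a * b * c)) powr (1 + \<epsilon>)"
    and "C > 0" "\<epsilon> > 0" and AP: "powerful_AP 3 N d"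
  shows "real N ^ 2 \<le> C * (real d * sqrt (real (N * (N + d) * (N + 2 * d)))) powr (1 + \<epsilon>)"
proof -
  have pos: "N > 0" "d > 0" and pow: "\<And>i. i < 3 \<Longrightarrow> powerful (N + i * d)"
    using AP by (auto simp: powerful_AP_def)
  define g where "g = gcd N d"
  obtain n e where ne: "N = g * n" "d = g * e" "coprime n e"
    using gcd_coprime_exists[of N d] pos unfolding g_def
    by (metis gcd_eq_0_iff less_irrefl mult.commute)
  have gne: "g > 0" "n > 0" "e > 0"
    using pos ne by auto
  define P where "P = n * (n + e) * (n + 2 * e)"
  define \<kappa> where "\<kappa> = kappa (int (e\<^sup>2) * int (n * (n + 2 * e)) * int ((n + e)\<^sup>2))"
  have dvd: "p\<^sup>2 dvd e\<^sup>2 * (g * P)"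
    if p: "prime p" "p dvd e\<^sup>2 * (n * (n + 2 * e)) * (n + e)\<^sup>2" for p :: nat
  proof (cases "p dvd e")
    case True
    then show ?thesis by (simp add: dvd_power_same)
  next
    case False
    then have "p dvd n + 0 * e \<or> p dvd n + 1 * e \<or> p dvd n + 2 * e"
      using p by (auto simp: prime_dvd_mult_iff prime_dvd_power_iff)
    moreover have "n + 0 * e dvd P" "n + 1 * e dvd P" "n + 2 * e dvd P"
      by (simp_all add: P_def)
    moreover have "0 < (3::nat)" "1 < (3::nat)" "2 < (3::nat)"
      by simp_all
    ultimately obtain i where i: "i < 3" "p dvd n + i * e" "n + i * e dvd P"
      by metis
    have eq: "N + i * d = g * (n + i * e)"
      by (simp add: ne algebra_simps)
    have "p\<^sup>2 dvd N + i * d"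
      using pow[OF i(1)] p(1) i(2) unfolding powerful_def eq by simp
    also have "\<dots> dvd g * P"
      unfolding eq using i(3) by (rule mult_dvd_mono[OF dvd_refl])
    finally show ?thesis by simp
  qed
  have "\<kappa>\<^sup>2 dvd int (e\<^sup>2 * (g * P))"
    unfolding \<kappa>_def
  proof (rule kappa_power2_dvd)
    fix p :: int
    assume p: "prime p" "p dvd int (e\<^sup>2) * int (n * (n + 2 * e)) * int ((n + e)\<^sup>2)"
    then obtain q where q: "p = int q" "prime q"
      by (metis prime_ge_0_int nonneg_int_cases prime_int_nat_transfer nat_int)
    then have "q\<^sup>2 dvd e\<^sup>2 * (g * P)"
      using p by (intro dvd) (simp_all flip: of_nat_mult of_nat_power)
    then show "p\<^sup>2 dvd int (e\<^sup>2 * (g * P))"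
      unfolding q by (metis int_dvd_int_iff of_nat_power)
  qed
  then have "\<kappa>\<^sup>2 \<le> int (e\<^sup>2 * (g * P))"
    using gne by (intro zdvd_imp_le) (auto simp: P_def)
  then have "real_of_int (\<kappa>\<^sup>2) \<le> real (e\<^sup>2 * (g * P))"
    by (metis of_int_le_iff of_int_of_nat_eq)
  \<comment> \<open>The factor \<open>g^4\<close> restores the original progression:
    \<open>g^4 e^2 g P = (g e)^2 (g^3 P)\<close>, one \<open>g\<close> going to each of the three
    terms.\<close>
  then have "real g ^ 4 * real_of_int (\<kappa>\<^sup>2) \<le> real g ^ 4 * real (e\<^sup>2 * (g * P))"
    by (intro mult_left_mono) auto
  also have "\<dots> = real d ^ 2 * real (N * (N + d) * (N + 2 * d))"
    by (simp add: ne P_def power2_eq_square power4_eq_xxxx algebra_simps)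
  finally have "(real g ^ 2 * real_of_int \<kappa>)\<^sup>2 \<le> real d ^ 2 * real (N * (N + d) * (N + 2 * d))"
    by (simp add: power_mult_distrib flip: power_mult)
  then have g\<kappa>: "real g ^ 2 * real_of_int \<kappa> \<le> real d * sqrt (real (N * (N + d) * (N + 2 * d)))"
    (is "_ \<le> ?R")
    by (metis real_le_rsqrt real_sqrt_mult real_sqrt_abs abs_of_nat)
  have "\<kappa> \<ge> 0"
    unfolding \<kappa>_def kappa_def by (intro prod_nonneg) (auto simp: prime_ge_0_int in_prime_factors_iff)
  have "coprime (e\<^sup>2) (n * (n + 2 * e))"
  proof -
    have "coprime e (n + 2 * e)"
      using ne(3) by (metis coprime_iff_gcd_eq_1 add.commute gcd.commute gcd_add_mult)
    then show ?thesis
      using ne(3) by (simp add: coprime_commute)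
  qed
  then have "gcd (int (e\<^sup>2)) (int (n * (n + 2 * e))) = 1"
    by (metis coprime_iff_gcd_eq_1 coprime_int_iff)
  moreover have "int (e\<^sup>2) + int (n * (n + 2 * e)) = int ((n + e)\<^sup>2)"
    by (simp add: power2_eq_square algebra_simps)
  ultimately have max: "real_of_int (Max {\<bar>int (e\<^sup>2)\<bar>, \<bar>int (n * (n + 2 * e))\<bar>, \<bar>int ((n + e)\<^sup>2)\<bar>})
      \<le> C * real_of_int \<kappa> powr (1 + \<epsilon>)"
    unfolding \<kappa>_def by (intro abc)
  \<comment> \<open>Of the three entries of the maximum, only \<open>(n + e)^2\<close> is
    kept.\<close>
  have "int (n\<^sup>2) \<le> int ((n + e)\<^sup>2)"
    by (simp add: power_mono)
  then have "int (n\<^sup>2) \<le> Max {\<bar>int (e\<^sup>2)\<bar>, \<bar>int (n * (n + 2 * e))\<bar>, \<bar>int ((n + e)\<^sup>2)\<bar>}"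
    by (subst Max_ge_iff) auto
  with max have n: "real n ^ 2 \<le> C * real_of_int \<kappa> powr (1 + \<epsilon>)"
    by (smt (verit) of_int_le_iff of_int_of_nat_eq of_nat_power)
  have "real N ^ 2 = real g ^ 2 * real n ^ 2"
    by (simp add: ne power_mult_distrib)
  also have "\<dots> \<le> real g ^ 2 * (C * real_of_int \<kappa> powr (1 + \<epsilon>))"
    using n by (intro mult_left_mono) auto
  also have "\<dots> = C * ((real g ^ 2) powr 1 * real_of_int \<kappa> powr (1 + \<epsilon>))"
    using gne by simp
  \<comment> \<open>Since \<open>g \<ge> 1\<close>, raising the exponent of \<open>g^2\<close> only
    enlarges it; then \<open>g^2\<close> and \<open>\<kappa>\<close> share one power and the bound
    on their product applies.\<close>
  also have "\<dots> \<le> C * ((real g ^ 2) powr (1 + \<epsilon>) * real_of_int \<kappa> powr (1 + \<epsilon>))"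
    using gne assms(2,3) by (intro mult_left_mono mult_right_mono powr_mono) auto
  also have "\<dots> = C * (real g ^ 2 * real_of_int \<kappa>) powr (1 + \<epsilon>)"
    using \<open>\<kappa> \<ge> 0\<close> by (simp add: powr_mult)
  also have "\<dots> \<le> C * ?R powr (1 + \<epsilon>)"
    using g\<kappa> assms(2,3) \<open>\<kappa> \<ge> 0\<close> by (intro mult_left_mono powr_mono2) auto
  finally show ?thesis .
qed

section \<open>No admissible exponent below 1/2\<close>

lemma abc_admissible_exponent_ge_half:
  assumes abc: "abc_conjecture" and adm: "admissible_exponent 3 \<theta>"
  shows "\<theta> \<ge> 1 / 2"
proof (rule ccontr)
  assume "\<not> \<theta> \<ge> 1 / 2"
  then have \<theta>: "0 < \<theta>" "\<theta> < 1 / 2"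
    using adm by (auto simp: admissible_exponent_def)
  obtain D where "D > 0" and inf: "infinite {(N, d). powerful_AP 3 N d \<and> real d \<le> D * real N powr \<theta>}"
    (is "infinite ?S")
    using adm unfolding admissible_exponent_def by blast
  \<comment> \<open>With this choice \<open>2 - (\<theta> + 3/2) = 4 \<epsilon>\<close>, and
    \<open>\<theta> + 3/2 < 2\<close> gives \<open>\<delta> > 2 \<epsilon>\<close>. Here
    \<open>\<delta>\<close> is the power of \<open>N\<close> that survives when the upper bound is
    divided into \<open>N^2\<close>.\<close>
  define \<epsilon> where "\<epsilon> = (1 / 2 - \<theta>) / 4"
  define \<delta> where "\<delta> = 2 - (\<theta> + 3 / 2) * (1 + \<epsilon>)"
  have "\<epsilon> > 0"
    using \<theta> by (simp add: \<epsilon>_def)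
  have "\<delta> > 0"
  proof -
    have "(\<theta> + 3 / 2) * \<epsilon> < 2 * \<epsilon>"
      using \<theta> \<open>\<epsilon> > 0\<close> by (intro mult_strict_right_mono) auto
    moreover have "\<delta> = 4 * \<epsilon> - (\<theta> + 3 / 2) * \<epsilon>"
      unfolding \<delta>_def by (simp add: \<epsilon>_def field_simps)
    ultimately show ?thesis
      using \<open>\<epsilon> > 0\<close> by linarith
  qed
  obtain C where "C > 0" and C: "\<And>a b c :: int. a + b = c \<Longrightarrow> gcd a b = 1 \<Longrightarrow>
      real_of_int (Max {\<bar>a\<bar>, \<bar>b\<bar>, \<bar>c\<bar>}) \<le> C * real_of_int (kappa (a * b * c)) powr (1 + \<epsilon>)"
    using abc \<open>\<epsilon> > 0\<close> unfolding abc_conjecture_def by blast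
  \<comment> \<open>As \<open>d \<le> D N\<close>, every term of the progression is at most
    \<open>K N\<close>.\<close>
  define K where "K = 1 + 2 * D"
  have "K > 0"
    using \<open>D > 0\<close> by (simp add: K_def)
  define M where "M = C * (D * K) powr (1 + \<epsilon>)"
  have bound: "real N \<le> M powr (1 / \<delta>) \<and> real d \<le> D * M powr (1 / \<delta>)"
    if AP: "powerful_AP 3 N d" and d: "real d \<le> D * real N powr \<theta>" for N d
  proof -
    have N: "real N \<ge> 1"
      using AP by (simp add: powerful_AP_def)
    then have "real N powr \<theta> \<le> real N powr 1"
      using \<theta> by (intro powr_mono) auto
    then have dN: "real d \<le> D * real N"
      using d \<open>D > 0\<close> N by (smt (verit) mult_left_mono powr_one)
    have "real (N * (N + d) * (N + 2 * d)) = real N * (real N + real d) * (real N + 2 * real d)"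
      by simp
    also have "\<dots> \<le> real N * (K * real N) * (K * real N)"
    proof -
      have "real N + real d \<le> K * real N" "real N + 2 * real d \<le> K * real N"
        using dN by (simp_all add: K_def algebra_simps)
      then show ?thesis
        using \<open>K > 0\<close> by (intro mult_mono) auto
    qed
    also have "\<dots> = K\<^sup>2 * real N ^ 3"
      by (simp add: power2_eq_square power3_eq_cube)
    finally have "sqrt (real (N * (N + d) * (N + 2 * d))) \<le> sqrt (K\<^sup>2 * real N ^ 3)"
      by (rule real_sqrt_le_mono)
    also have "\<dots> = K * real N powr (3 / 2)"
    proof -
      have "real N ^ 3 = real N powr 3"
        using N by (simp add: powr_numeral)
      then have "sqrt (real N ^ 3) = (real N powr 3) powr (1 / 2)"
        by (simp add: powr_half_sqrt)
      then have "sqrt (real N ^ 3) = real N powr (3 / 2)"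
        unfolding powr_powr by simp
      then show ?thesis
        using \<open>K > 0\<close> by (simp add: real_sqrt_mult)
    qed
    finally have "real d * sqrt (real (N * (N + d) * (N + 2 * d)))
        \<le> (D * real N powr \<theta>) * (K * real N powr (3 / 2))"
      using d \<open>D > 0\<close> by (intro mult_mono) auto
    also have "\<dots> = (D * K) * real N powr (\<theta> + 3 / 2)"
      by (simp add: powr_add)
    finally have R: "real d * sqrt (real (N * (N + d) * (N + 2 * d)))
        \<le> (D * K) * real N powr (\<theta> + 3 / 2)" .
    have "real N powr 2 = real N ^ 2"
      using N by (simp add: powr_numeral)
    also have "\<dots> \<le> C * (real d * sqrt (real (N * (N + d) * (N + 2 * d)))) powr (1 + \<epsilon>)"
      using C \<open>C > 0\<close> \<open>\<epsilon> > 0\<close> AP by (rule abc_powerful_AP_bound)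
    also have "\<dots> \<le> C * ((D * K) * real N powr (\<theta> + 3 / 2)) powr (1 + \<epsilon>)"
      using R \<open>C > 0\<close> \<open>\<epsilon> > 0\<close> by (intro mult_left_mono powr_mono2) auto
    also have "\<dots> = M * real N powr ((\<theta> + 3 / 2) * (1 + \<epsilon>))"
      using \<open>D > 0\<close> \<open>K > 0\<close> by (simp add: M_def powr_mult powr_powr)
    finally have "real N powr 2 / real N powr ((\<theta> + 3 / 2) * (1 + \<epsilon>)) \<le> M"
      using N by (simp add: divide_le_eq)
    then have "real N powr \<delta> \<le> M"
      by (simp add: \<delta>_def powr_diff)
    then have "(real N powr \<delta>) powr (1 / \<delta>) \<le> M powr (1 / \<delta>)"
      using \<open>\<delta> > 0\<close> by (intro powr_mono2) auto
    then have "real N \<le> M powr (1 / \<delta>)"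
      using \<open>\<delta> > 0\<close> N by (simp add: powr_powr)
    then show ?thesis
      using dN \<open>D > 0\<close> by (smt (verit) mult_left_mono)
  qed
  \<comment> \<open>Both coordinates are bounded, so the pairs lie in a finite box.\<close>
  have "?S \<subseteq> {..nat \<lfloor>M powr (1 / \<delta>)\<rfloor>} \<times> {..nat \<lfloor>D * M powr (1 / \<delta>)\<rfloor>}"
    using bound by (auto simp: le_nat_floor)
  then have "finite ?S"
    by (rule finite_subset) simp
  with inf show False by simp
qed

theorem theorem2:
  assumes "abc_conjecture"
  shows "theta 3 = 1 / 2"
  unfolding theta_def
  using admissible_exponent_half abc_admissible_exponent_ge_half[OF assms]
  \<comment> \<open>The infimum is attained: 1/2 is a member and a lower bound.\<close>
  by (intro cInf_eq_minimum) auto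

end
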